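(* Let $\phi=\{\phi_n(r)\}_{n=0}^{\infty}\in\mathcal{G}$ with $\phi_0(r)\le 1$ for $r\in[0,1)$, let $m\ge 2$ be an integer and let $1\le p,q<\infty$. If $r=0$ is the only zero of $\phi_1(r)$ in $[0,1)$, then $R_{p,q,\phi}(\mathbb{D},\mathbb{C}^m_\infty)=0$.
   Context: $\mathbb{D}=\{z\in\mathbb{C}:|z|<1\}$. $\mathcal{G}$ is the set of all sequences $\phi=\{\phi_n(r)\}_{n=0}^{\infty}$ of non-negative continuous functions on $[0,1)$ such that $\sum_{n=0}^{\infty}\phi_n(r)$ converges locally uniformly with respect to $r\in[0,1)$. $\mathbb{C}^m_\infty$ is $\mathbb{C}^m$ with $\|w\|_\infty=\sup_{1\le i\le m}|w_i|$. For a complex Banach space $X$, $H^{\infty}(\mathbb{D},X)$ is the space of bounded analytic functions $f:\mathbb{D}\to X$, with $\|f\|_{H^\infty(\mathbb{D},X)}=\sup_{z\in\mathbb{D}}\|f(z)\|$. For $f(z)=\sum_{n=0}^\infty x_nz^n$ in $H^\infty(\mathbb{D},X)$ with $\|f\|_{H^\infty(\mathbb{D},X)}\le 1$, for $\phi\in\mathcal{G}$ with $\phi_0(r)\le1$, and for $1\le p,q<\infty$, put $$R_{p,q,\phi}(f,\mathbb{D},X)=\sup\Big\{r\in[0,1):\ \|x_0\|^p\phi_0(r)+\Big(\sum_{n=1}^\infty\|x_n\|\phi_n(r)\Big)^q\le\phi_0(r)\Big\},$$ and $R_{p,q,\phi}(\mathbb{D},X)=\inf\{R_{p,q,\phi}(f,\mathbb{D},X):\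 \|f\|_{H^\infty(\mathbb{D},X)}\le 1\}$. *)

theory Defs
  imports "HOL-Analysis.Analysis"
begin

text \<open>The distribution only has real Banach spaces; a complex one is a real one with a
  compatible multiplication by complex scalars.\<close>

class complex_banach = banach +
  fixes scaleC :: "complex \<Rightarrow> 'a \<Rightarrow> 'a" (infixr \<open>*\<^sub>C\<close> 75)
  assumes scaleC_add_right: "a *\<^sub>C (x + y) = a *\<^sub>C x + a *\<^sub>C y"
    and scaleC_add_left: "(a + b) *\<^sub>C x = a *\<^sub>C x + b *\<^sub>C x"
    and scaleC_scaleC: "a *\<^sub>C (b *\<^sub>C x) = (a * b) *\<^sub>C x"
    and scaleC_of_real: "complex_of_real r *\<^sub>C x = r *\<^sub>R x"
    and norm_scaleC: "norm (a *\<^sub>C x) = cmod a * norm x"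

text \<open>A copy of \<^typ>\<open>complex ^ 'm\<close>, whose own norm is the Euclidean one; here
  \<open>m = CARD('m)\<close>.\<close>

typedef 'm cinf = "UNIV :: (complex ^ ('m::finite)) set"
  morphisms vec_of_cinf cinf_of_vec ..

lemmas cinf_simps [simp] = cinf_of_vec_inverse [OF UNIV_I] vec_of_cinf_inverse

lemma cinf_eq_iff: "x = y \<longleftrightarrow> vec_of_cinf x = vec_of_cinf y"
  by (simp add: vec_of_cinf_inject)

instantiation cinf :: (finite) real_vector
begin

definition "0 = cinf_of_vec 0"
definition "x + y = cinf_of_vec (vec_of_cinf x + vec_of_cinf y)"
definition "x - y = cinf_of_vec (vec_of_cinf x - vec_of_cinf y)"
definition "- x = cinf_of_vec (- vec_of_cinf x)"
definition "r *\<^sub>R x = cinf_of_vec (r *\<^sub>R vec_of_cinf x)"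
lemmas cinf_defs = zero_cinf_def plus_cinf_def minus_cinf_def uminus_cinf_def scaleR_cinf_def

instance
  by standard (simp_all add: cinf_defs algebra_simps)

end

instantiation cinf :: (finite) real_normed_vector
begin

definition "norm x = (SUP i. cmod (vec_of_cinf x $ i))"
definition "sgn x = x /\<^sub>R norm x" for x :: "'a cinf"
definition "dist x y = norm (x - y)" for x y :: "'a cinf"
definition "uniformity = (INF e\<in>{0<..}. principal {(x :: 'a cinf, y). dist x y < e})"
definition "open U \<longleftrightarrow> (\<forall>x\<in>U. \<forall>\<^sub>F (x', y) in uniformity. x' = x \<longrightarrow> y \<in> U)"
  for U :: "'a cinf set"

lemma cmod_le_norm_cinf: "cmod (vec_of_cinf x $ i) \<le> norm x"
  unfolding norm_cinf_def by (rule cSUP_upper) auto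

lemma norm_cinf_le: "norm x \<le> c" if "\<And>i. cmod (vec_of_cinf x $ i) \<le> c"
  unfolding norm_cinf_def by (rule cSUP_least) (use that in auto)

instance
proof
  fix x y :: "'a cinf" and a :: real
  show "dist x y = norm (x - y)" "sgn x = x /\<^sub>R norm x"
    by (rule dist_cinf_def sgn_cinf_def)+
  show "uniformity = (INF e\<in>{0<..}. principal {(x :: 'a cinf, y). dist x y < e})"
    by (rule uniformity_cinf_def)
  show "open U \<longleftrightarrow> (\<forall>x\<in>U. \<forall>\<^sub>F (x', y) in uniformity. x' = x \<longrightarrow> y \<in> U)" for U :: "'a cinf set"
    by (rule open_cinf_def)
  show "norm x = 0 \<longleftrightarrow> x = 0"
  proof
    assume "norm x = 0"
    then have "cmod (vec_of_cinf x $ i) \<le> 0" for i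
      using cmod_le_norm_cinf[of x i] by simp
    then show "x = 0"
      by (simp add: cinf_eq_iff zero_cinf_def vec_eq_iff)
  qed (simp add: norm_cinf_def zero_cinf_def)
  show "norm (x + y) \<le> norm x + norm y"
  proof (rule norm_cinf_le)
    fix i
    have "cmod (vec_of_cinf (x + y) $ i) \<le> cmod (vec_of_cinf x $ i) + cmod (vec_of_cinf y $ i)"
      by (simp add: plus_cinf_def norm_triangle_ineq)
    then show "cmod (vec_of_cinf (x + y) $ i) \<le> norm x + norm y"
      using cmod_le_norm_cinf[of x i] cmod_le_norm_cinf[of y i] by linarith
  qed
  have le: "norm (a *\<^sub>R x) \<le> \<bar>a\<bar> * norm x" for a and x :: "'a cinf"
    by (rule norm_cinf_le) (simp add: scaleR_cinf_def cmod_le_norm_cinf mult_left_mono)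
  show "norm (a *\<^sub>R x) = \<bar>a\<bar> * norm x"
  proof (cases "a = 0")
    case True
    then show ?thesis by (simp add: norm_cinf_def scaleR_cinf_def)
  next
    case False
    have "x = inverse a *\<^sub>R (a *\<^sub>R x)"
      using False by (simp add: scaleR_cinf_def)
    then have "norm x \<le> \<bar>inverse a\<bar> * norm (a *\<^sub>R x)"
      using le[of "inverse a" "a *\<^sub>R x"] by simp
    then have "\<bar>a\<bar> * norm x \<le> norm (a *\<^sub>R x)"
      using False by (simp add: field_simps)
    with le[of a x] show ?thesis by simp
  qed
qed

end

lemma norm_vec_of_cinf_le: "norm (vec_of_cinf x) \<le> real CARD('m) * norm x"
  for x :: "'m::finite cinf"
proof -
  have "norm (vec_of_cinf x) \<le> (\<Sum>i\<in>UNIV. cmod (vec_of_cinf x $ i))"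
    unfolding norm_vec_def by (rule L2_set_le_sum) simp
  also have "\<dots> \<le> (\<Sum>i\<in>(UNIV :: 'm set). norm x)"
    by (rule sum_mono) (rule cmod_le_norm_cinf)
  finally show ?thesis by simp
qed

lemma norm_cinf_le_norm_vec: "norm x \<le> norm (vec_of_cinf x)"
  by (rule norm_cinf_le) (rule Finite_Cartesian_Product.norm_nth_le)

instantiation cinf :: (finite) complex_banach
begin

definition "a *\<^sub>C x = cinf_of_vec (a *s vec_of_cinf x)"

instance
proof
  fix X :: "nat \<Rightarrow> 'a cinf"
  assume X: "Cauchy X"
  have "Cauchy (\<lambda>n. vec_of_cinf (X n))"
  proof (rule metric_CauchyI)
    fix e :: real assume e: "0 < e"
    then obtain M where M: "\<And>m n. m \<ge> M \<Longrightarrow> n \<ge> M \<Longrightarrow> norm (X m - X n) < e / CARD('a)"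
      using CauchyD[OF X, of "e / CARD('a)"] by auto
    have "dist (vec_of_cinf (X m)) (vec_of_cinf (X n)) < e" if "m \<ge> M" "n \<ge> M" for m n
    proof -
      have "dist (vec_of_cinf (X m)) (vec_of_cinf (X n)) = norm (vec_of_cinf (X m - X n))"
        by (simp add: dist_norm minus_cinf_def)
      also have "\<dots> \<le> CARD('a) * norm (X m - X n)"
        by (rule norm_vec_of_cinf_le)
      also have "\<dots> < e"
        using M[OF that] by (simp add: field_simps)
      finally show ?thesis .
    qed
    then show "\<exists>M. \<forall>m\<ge>M. \<forall>n\<ge>M. dist (vec_of_cinf (X m)) (vec_of_cinf (X n)) < e"
      by blast
  qed
  then obtain L where L: "(\<lambda>n. vec_of_cinf (X n)) \<longlonglongrightarrow> L"
    by (auto simp: Cauchy_convergent_iff convergent_def)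
  have "X \<longlonglongrightarrow> cinf_of_vec L"
  proof (rule metric_LIMSEQ_I)
    fix e :: real assume "0 < e"
    then obtain N where N: "\<And>n. n \<ge> N \<Longrightarrow> norm (vec_of_cinf (X n) - L) < e"
      using LIMSEQ_D[OF L] by blast
    have "dist (X n) (cinf_of_vec L) < e" if "n \<ge> N" for n
      using N[OF that] norm_cinf_le_norm_vec[of "X n - cinf_of_vec L"]
      by (simp add: dist_norm minus_cinf_def)
    then show "\<exists>N. \<forall>n\<ge>N. dist (X n) (cinf_of_vec L) < e" by blast
  qed
  then show "convergent X" by (auto simp: convergent_def)
next
  fix x y :: "'a cinf" and a b :: complex and r :: real
  show "a *\<^sub>C (x + y) = a *\<^sub>C x + a *\<^sub>C y" "(a + b) *\<^sub>C x = a *\<^sub>C x + b *\<^sub>C x"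
    "a *\<^sub>C (b *\<^sub>C x) = (a * b) *\<^sub>C x" "complex_of_real r *\<^sub>C x = r *\<^sub>R x"
    by (simp_all add: scaleC_cinf_def cinf_defs cinf_of_vec_inject vec_eq_iff algebra_simps
        scaleR_conv_of_real[where 'a = complex])
  have le: "norm (a *\<^sub>C x) \<le> cmod a * norm x" for a and x :: "'a cinf"
    by (rule norm_cinf_le) (simp add: scaleC_cinf_def norm_mult cmod_le_norm_cinf mult_left_mono)
  show "norm (a *\<^sub>C x) = cmod a * norm x"
  proof (cases "a = 0")
    case True
    then show ?thesis by (simp add: norm_cinf_def scaleC_cinf_def)
  next
    case False
    have "x = inverse a *\<^sub>C (a *\<^sub>C x)"
      using False by (simp add: scaleC_cinf_def)
    then have "norm x \<le> cmod (inverse a) * norm (a *\<^sub>C x)"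
      using le[of "inverse a" "a *\<^sub>C x"] by simp
    then have "cmod a * norm x \<le> norm (a *\<^sub>C x)"
      using False by (simp add: norm_inverse norm_divide field_simps)
    with le[of a x] show ?thesis by simp
  qed
qed

end

text \<open>Functions on the disk are total functions whose values outside the disk never matter.\<close>

definition Hinf :: "(complex \<Rightarrow> 'a::complex_banach) set" where
  "Hinf = {f. (\<forall>z\<in>ball 0 1. \<exists>D. (f has_derivative (\<lambda>h. h *\<^sub>C D)) (at z)) \<and>
              bounded (f ` ball 0 1)}"

definition Hinf_norm :: "(complex \<Rightarrow> 'a::complex_banach) \<Rightarrow> real" where
  "Hinf_norm f = (SUP z\<in>ball 0 1. norm (f z))"

text \<open>An analytic function on the disk is the sum of a unique power series there.\<close>

definition power_coeffs :: "(complex \<Rightarrow> 'a::complex_banach) \<Rightarrow> nat \<Rightarrow> 'a" where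
  "power_coeffs f = (THE x. \<forall>z\<in>ball 0 1. (\<lambda>n. z ^ n *\<^sub>C x n) sums f z)"

definition G_class :: "(nat \<Rightarrow> real \<Rightarrow> real) set" where
  "G_class = {\<phi>. (\<forall>n. continuous_on {0..<1} (\<phi> n)) \<and>
                 (\<forall>n. \<forall>r\<in>{0..<1}. 0 \<le> \<phi> n r) \<and>
                 (\<forall>r\<in>{0..<1}. \<exists>e>0. uniformly_convergent_on (ball r e \<inter> {0..<1})
                                      (\<lambda>N s. \<Sum>n<N. \<phi> n s))}"

text \<open>The set of admissible radii may be empty (e.g. \<open>\<phi>\<^sub>0 = 0\<close>, \<open>\<phi>\<^sub>2 = 1\<close> and
  a function with nonzero second coefficient). The supremum is taken in \<open>[0, 1]\<close>, so that the
  empty set has supremum \<open>0\<close>; inserting \<open>0\<close> changes nothing otherwise.\<close>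

definition bohr_radius_of ::
  "real \<Rightarrow> real \<Rightarrow> (nat \<Rightarrow> real \<Rightarrow> real) \<Rightarrow> (complex \<Rightarrow> 'a::complex_banach) \<Rightarrow> real" where
  "bohr_radius_of p q \<phi> f =
     Sup (insert 0 {r \<in> {0..<1}.
       norm (power_coeffs f 0) powr p * \<phi> 0 r
         + (\<Sum>n. norm (power_coeffs f (Suc n)) * \<phi> (Suc n) r) powr q \<le> \<phi> 0 r})"

definition bohr_radius ::
  "real \<Rightarrow> real \<Rightarrow> (nat \<Rightarrow> real \<Rightarrow> real) \<Rightarrow> 'a::complex_banach itself \<Rightarrow> real" where
  "bohr_radius p q \<phi> X =
     Inf {bohr_radius_of p q \<phi> f | f :: complex \<Rightarrow> 'a. f \<in> Hinf \<and> Hinf_norm f \<le> 1}"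

end

theory Submission imports Defs begin

text \<open>A scalar analytic function bounded by \<open>1\<close> on the disk satisfies \<open>\<bar>a\<^sub>1\<bar> \<le> 1 - \<bar>a\<^sub>0\<bar>\<^sup>2\<close>, so it is constant if
  its constant term has modulus \<open>1\<close>. In the maximum norm on at least two coordinates this
  fails: for distinct coordinate vectors \<open>e\<^sub>i\<close>, \<open>e\<^sub>j\<close> the function \<open>f z = e\<^sub>i + z e\<^sub>j\<close> has norm
  \<open>max 1 \<bar>z\<bar> = 1\<close> throughout the disk, while both of its Taylor coefficients are unit vectors.
  For this \<open>f\<close> the Bohr inequality reads \<open>\<phi>\<^sub>0(r) + \<phi>\<^sub>1(r)\<^sup>q \<le> \<phi>\<^sub>0(r)\<close>, which forces
  \<open>\<phi>\<^sub>1(r) = 0\<close> and hence \<open>r = 0\<close>. So a single function already has radius \<open>0\<close>, and since all radii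
  are non-negative their infimum is \<open>0\<close> (\<open>bohr_radius_eq_0I\<close>).

  Reading off the Taylor coefficients of \<open>f\<close> requires the uniqueness of power series
  coefficients (\<open>power_coeffs_cinf_eqI\<close>), which is reduced to scalar series coordinate by
  coordinate.\<close>

lemma bounded_linear_scaleC_left: "bounded_linear (\<lambda>z. z *\<^sub>C x)"
  for x :: "'a::complex_banach"
proof (rule bounded_linear_intro)
  show "(r *\<^sub>R z) *\<^sub>C x = r *\<^sub>R (z *\<^sub>C x)" for r z
    by (metis scaleC_of_real scaleC_scaleC scaleR_conv_of_real)
  show "norm (z *\<^sub>C x) \<le> norm z * norm x" for z
    by (simp add: norm_scaleC)
qed (simp add: scaleC_add_left)

lemma bounded_linear_scaleC_right: "bounded_linear (\<lambda>x. a *\<^sub>C x)"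
  for a :: complex
proof (rule bounded_linear_intro)
  show "a *\<^sub>C (r *\<^sub>R x) = r *\<^sub>R (a *\<^sub>C x)" for r and x :: "'a::complex_banach"
    by (metis mult.commute scaleC_of_real scaleC_scaleC)
  show "norm (a *\<^sub>C x) \<le> norm x * cmod a" for x :: "'a::complex_banach"
    by (simp add: norm_scaleC mult.commute)
qed (simp add: scaleC_add_right)

lemma scaleC_zero_left [simp]: "0 *\<^sub>C x = (0::'a::complex_banach)"
  using linear_0[OF bounded_linear.linear[OF bounded_linear_scaleC_left]] .

lemma scaleC_zero_right [simp]: "a *\<^sub>C 0 = (0::'a::complex_banach)"
  using linear_0[OF bounded_linear.linear[OF bounded_linear_scaleC_right]] .

lemma scaleC_one [simp]: "1 *\<^sub>C x = (x::'a::complex_banach)"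
  using scaleC_of_real[of 1 x] by simp

lemma bounded_linear_cinf_nth: "bounded_linear (\<lambda>x. vec_of_cinf x $ i)"
proof (rule bounded_linear_intro)
  show "cmod (vec_of_cinf x $ i) \<le> norm x * 1" for x
    using cmod_le_norm_cinf[of x i] by simp
qed (simp_all add: cinf_defs)

text \<open>Once the coefficients below \<open>n\<close> are known to vanish, \<open>a n\<close> is the limit at \<open>0\<close> of the
  series divided by \<open>z ^ n\<close>.\<close>

lemma powser_sums_zero_imp_coeffs_eq_0:
  fixes a :: "nat \<Rightarrow> 'a::{real_normed_field,banach}"
  assumes "0 < s" and sums: "\<And>z. norm z < s \<Longrightarrow> (\<lambda>n. a n * z ^ n) sums 0"
  shows "a n = 0"
proof (induction n rule: less_induct)
  case (less n)
  have "(\<lambda>k. a (k + n) * z ^ k) sums 0" if "z \<noteq> 0" "norm z < s" for z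
  proof -
    have "(\<Sum>k<n. a k * z ^ k) = 0"
      using less.IH by simp
    then have "(\<lambda>k. a (k + n) * z ^ (k + n)) sums 0"
      using sums_split_initial_segment[OF sums[OF that(2)], of n] by simp
    from sums_divide[OF this, of "z ^ n"] show ?thesis
      using that by (simp add: power_add)
  qed
  from powser_limit_0_strong[OF \<open>0 < s\<close> this]
  have "((\<lambda>z. 0) \<longlongrightarrow> a n) (at (0::'a))"
    by simp
  then show "a n = 0"
    using LIM_const_eq by fastforce
qed

lemma power_coeffs_cinf_eqI:
  fixes f :: "complex \<Rightarrow> 'm::finite cinf"
  assumes "\<And>z. z \<in> ball 0 1 \<Longrightarrow> (\<lambda>n. z ^ n *\<^sub>C x n) sums f z"
  shows "power_coeffs f = x"
  unfolding power_coeffs_def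
proof (rule the_equality)
  fix y assume y: "\<forall>z\<in>ball 0 1. (\<lambda>n. z ^ n *\<^sub>C y n) sums f z"
  show "y = x"
  proof
    fix n
    have "vec_of_cinf (y n) $ i = vec_of_cinf (x n) $ i" for i
    proof -
      have S: "(\<lambda>n. vec_of_cinf (w n) $ i * z ^ n) sums (vec_of_cinf (f z) $ i)"
        if "z \<in> ball 0 1" "(\<lambda>n. z ^ n *\<^sub>C w n) sums f z" for w z
        using bounded_linear.sums[OF bounded_linear_cinf_nth that(2)]
        by (simp add: scaleC_cinf_def mult.commute)
      have "(\<lambda>n. (vec_of_cinf (y n) $ i - vec_of_cinf (x n) $ i) * z ^ n) sums 0"
        if "norm z < 1" for z
        using sums_diff[OF S S, of z y z x] that assms[of z] y by (simp add: left_diff_distrib)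
      from powser_sums_zero_imp_coeffs_eq_0[of 1, OF _ this, of n] show ?thesis
        by simp
    qed
    then show "y n = x n"
      by (simp add: cinf_eq_iff vec_eq_iff)
  qed
qed (use assms in blast)

lemma bohr_radius_of_nonneg: "0 \<le> bohr_radius_of p q \<phi> f"
  unfolding bohr_radius_of_def by (rule cSup_upper) (auto intro!: bdd_aboveI[of _ 1])

lemma bohr_radius_eq_0I:
  fixes f :: "complex \<Rightarrow> 'a::complex_banach"
  assumes "f \<in> Hinf" and "Hinf_norm f \<le> 1" and "bohr_radius_of p q \<phi> f = 0"
  shows "bohr_radius p q \<phi> TYPE('a) = 0"
  unfolding bohr_radius_def
  by (rule cInf_eq_minimum) (use assms bohr_radius_of_nonneg in \<open>force+\<close>)

lemma affine_in_Hinf: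
  fixes a b :: "'a::complex_banach"
  shows "(\<lambda>z. a + z *\<^sub>C b) \<in> Hinf"
proof -
  have "((\<lambda>z. a + z *\<^sub>C b) has_derivative (\<lambda>h. h *\<^sub>C b)) (at z)" for z
    using has_derivative_add[OF has_derivative_const
        bounded_linear_imp_has_derivative[OF bounded_linear_scaleC_left]] by simp
  moreover have "bounded ((\<lambda>z. a + z *\<^sub>C b) ` ball 0 1)"
  proof (rule boundedI, clarify)
    fix z :: complex assume "z \<in> ball 0 1"
    then have "norm (z *\<^sub>C b) \<le> norm b"
      by (simp add: norm_scaleC mult_left_le_one_le)
    then show "norm (a + z *\<^sub>C b) \<le> norm a + norm b"
      by (rule norm_triangle_le[OF add_left_mono])
  qed
  ultimately show ?thesis
    unfolding Hinf_def by blast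
qed

lemma power_coeffs_affine:
  fixes a b :: "'m::finite cinf"
  shows "power_coeffs (\<lambda>z. a + z *\<^sub>C b) = (\<lambda>n. if n = 0 then a else if n = 1 then b else 0)"
proof (rule power_coeffs_cinf_eqI)
  show "(\<lambda>n. z ^ n *\<^sub>C (if n = 0 then a else if n = 1 then b else 0)) sums (a + z *\<^sub>C b)" for z
    using sums_finite[of "{0,1}" "\<lambda>n. z ^ n *\<^sub>C (if n = 0 then a else if n = 1 then b else 0)"]
    by simp
qed

definition axis_cinf :: "'m::finite \<Rightarrow> 'm cinf" where
  "axis_cinf i = cinf_of_vec (axis i 1)"

lemma norm_axis_cinf: "norm (axis_cinf i) = 1"
proof (rule antisym)
  show "norm (axis_cinf i) \<le> 1"
    by (rule norm_cinf_le) (simp add: axis_cinf_def axis_def)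
  show "1 \<le> norm (axis_cinf i)"
    using cmod_le_norm_cinf[of "axis_cinf i" i] by (simp add: axis_cinf_def)
qed

text \<open>The two summands live in different coordinates, so the maximum norm does not add them up.\<close>

lemma norm_axis_add_axis_le:
  assumes "i \<noteq> j" and "cmod z \<le> 1"
  shows "norm (axis_cinf i + z *\<^sub>C axis_cinf j) \<le> 1"
  using assms
  by (intro norm_cinf_le) (auto simp: axis_cinf_def plus_cinf_def scaleC_cinf_def axis_def)

theorem proposition1p23:
  fixes \<phi> :: "nat \<Rightarrow> real \<Rightarrow> real" and p q :: real
  assumes "\<phi> \<in> G_class"
    and "\<And>r. r \<in> {0..<1} \<Longrightarrow> \<phi> 0 r \<le> 1"
    and "CARD('m::finite) \<ge> 2"
    and "1 \<le> p" and "1 \<le> q"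
    and "{r \<in> {0..<1}. \<phi> 1 r = 0} = {0}"
  shows "bohr_radius p q \<phi> TYPE('m cinf) = 0"
proof -
  obtain i j :: 'm where ij: "i \<noteq> j"
    using assms(3) by (metis card_2_iff' ex_card UNIV_I)
  define f where "f z = axis_cinf i + z *\<^sub>C axis_cinf j" for z
  have "f \<in> Hinf"
    unfolding f_def by (rule affine_in_Hinf)
  moreover have "Hinf_norm f \<le> 1"
    unfolding Hinf_norm_def f_def
    by (rule cSUP_least) (use norm_axis_add_axis_le[OF ij] in auto)
  moreover have "bohr_radius_of p q \<phi> f = 0"
  proof -
    have c: "power_coeffs f = (\<lambda>n. if n = 0 then axis_cinf i else if n = 1 then axis_cinf j else 0)"
      unfolding f_def by (rule power_coeffs_affine)
    have "(\<Sum>n. norm (power_coeffs f (Suc n)) * \<phi> (Suc n) r) = \<phi> 1 r" for r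
      using suminf_finite[of "{0}" "\<lambda>n. norm (power_coeffs f (Suc n)) * \<phi> (Suc n) r"]
      by (simp add: c norm_axis_cinf)
    moreover have "r = 0" if "r \<in> {0..<1}" "\<phi> 0 r + \<phi> 1 r powr q \<le> \<phi> 0 r" for r
    proof -
      have "\<phi> 1 r powr q \<le> 0" using that by simp
      then have "\<phi> 1 r = 0" by (meson powr_eq_0_iff powr_ge_zero order_antisym)
      then show ?thesis using assms(6) that by blast
    qed
    ultimately have "insert 0 {r \<in> {0..<1}.
       norm (power_coeffs f 0) powr p * \<phi> 0 r
         + (\<Sum>n. norm (power_coeffs f (Suc n)) * \<phi> (Suc n) r) powr q \<le> \<phi> 0 r} = {0}"
      by (auto simp: c norm_axis_cinf)
    then show ?thesis
      unfolding bohr_radius_of_def by (simp only: cSup_singleton)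
  qed
  ultimately show ?thesis
    by (rule bohr_radius_eq_0I)
qed

end
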